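(* Let $\mathcal{X}\subseteq\mathbb{R}^n$ be open and convex, let $\mathcal{U}\subseteq\mathbb{R}^m$ be open, and let $f:\mathcal{X}\times\mathcal{U}\to\mathcal{X}$ be surjective. Consider the discrete-time controlled system $x^+=f(x,u)$. Then the system admits an $N$-step linear predictor for every $N\in\{1,\ldots,n+1\}$ if and only if there exists an invertible matrix $T\in\mathbb{R}^{n\times n}$ such that, in the coordinates $\tilde{x}=\mathrm{col}(\tilde{x}_1,\tilde{x}_2):=Tx$ (for some partition of the coordinates of $\tilde x$ into two consecutive blocks), the dynamics take the control-affine preserved (CAP) form $$\begin{bmatrix}\tilde{x}_1^{+}\\ \tilde{x}_2^{+}\end{bmatrix}=\begin{bmatrix} g(\tilde{x}_2)+C\tilde{x}_1\\ h(\tilde{x}_2)\end{bmatrix}+\begin{bmatrix} D\\ 0\end{bmatrix}u,\qquad \forall \tilde{x}\in\tilde{\mathcal{X}},\ u\in\mathcal{U},$$ where $\tilde{\mathcal{X}}:=\{Tx\mid x\in\mathcal{X}\}$, and $g,h$ are some functions and $C,D$ some constant real matrices of appropriate dimensions.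
   Context: $\mathrm{col}(a,b)$ denotes vertical stacking of vectors. For an initial state $x\in\mathcal{X}$ and inputs $u_0,\ldots,u_{N-1}\in\mathcal{U}$, $x(N)$ denotes the state after $N$ steps: $x(0)=x$, $x(t+1)=f(x(t),u_t)$; and $u_{0:N-1}:=\mathrm{col}(u_0,\ldots,u_{N-1})\in\mathbb{R}^{Nm}$. The system admits an $N$-step linear predictor if there exist a function $\Phi:\mathcal{X}\to\mathbb{R}^n$ and a constant matrix $B\in\mathbb{R}^{n\times Nm}$ such that $x(N)=\Phi(x)+Bu_{0:N-1}$ for all $x\in\mathcal{X}$ and all $u_{0:N-1}\in\mathcal{U}\times\cdots\times\mathcal{U}$ ($N$ times). In the CAP form, $\tilde x_1\in\mathbb{R}^{n_1}$, $\tilde x_2\in\mathbb{R}^{n_2}$ with $n_1+n_2=n$, and either block may be empty: if $n_1=0$ the system is autonomous ($\tilde x_2^+=h(\tilde x_2)$), and if $n_2=0$ the function $g$ is a constant vector and the system is affine. The functions $g,h$ are defined on the projection of $\tilde{\mathcal X}$ onto the $\tilde x_2$ coordinates. *)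

theory Defs
  imports
    "HOL-Analysis.Abstract_Euclidean_Space"
    "Jordan_Normal_Form.Matrix"
begin

unbundle no vec_syntax

text \<open>
  The dimensions \<open>n1\<close>, \<open>n2\<close> and \<open>N * m\<close> vary inside the statement, so \<open>\<real>\<^sup>k\<close> is
  \<open>carrier_vec k\<close> and the \<open>k\<close> by \<open>l\<close> real matrices are \<open>carrier_mat k l\<close>. The type \<open>real vec\<close>
  carries no topology; openness is taken from \<open>Euclidean_space k\<close>, whose points are the
  functions \<open>nat \<Rightarrow> real\<close> vanishing from index \<open>k\<close> on.
\<close>

definition vec_coords :: "real vec \<Rightarrow> nat \<Rightarrow> real" where
  "vec_coords x = (\<lambda>i. if i < dim_vec x then x $ i else 0)"

definition open_vec_set :: "nat \<Rightarrow> real vec set \<Rightarrow> bool" where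
  "open_vec_set k S \<longleftrightarrow> S \<subseteq> carrier_vec k \<and> openin (Euclidean_space k) (vec_coords ` S)"

definition convex_vec_set :: "real vec set \<Rightarrow> bool" where
  "convex_vec_set S \<longleftrightarrow>
     (\<forall>x\<in>S. \<forall>y\<in>S. \<forall>a\<ge>0. \<forall>b\<ge>0. a + b = 1 \<longrightarrow> a \<cdot>\<^sub>v x + b \<cdot>\<^sub>v y \<in> S)"

primrec state :: "(real vec \<Rightarrow> real vec \<Rightarrow> real vec) \<Rightarrow> real vec \<Rightarrow> (nat \<Rightarrow> real vec) \<Rightarrow> nat \<Rightarrow> real vec" where
  "state f x u 0 = x"
| "state f x u (Suc t) = f (state f x u t) (u t)"

primrec stack :: "(nat \<Rightarrow> real vec) \<Rightarrow> nat \<Rightarrow> real vec" where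
  "stack u 0 = 0\<^sub>v 0"
| "stack u (Suc N) = stack u N @\<^sub>v u N"

definition linear_predictor ::
  "nat \<Rightarrow> nat \<Rightarrow> real vec set \<Rightarrow> real vec set \<Rightarrow> (real vec \<Rightarrow> real vec \<Rightarrow> real vec) \<Rightarrow> nat \<Rightarrow> bool" where
  "linear_predictor n m X U f N \<longleftrightarrow>
     (\<exists>\<Phi> B. \<Phi> \<in> X \<rightarrow> carrier_vec n \<and> B \<in> carrier_mat n (N * m) \<and>
       (\<forall>x\<in>X. \<forall>u. (\<forall>t<N. u t \<in> U) \<longrightarrow> state f x u N = \<Phi> x + B *\<^sub>v stack u N))"

text \<open>
  With \<open>x\<close> ranging over \<open>X\<close>, the point \<open>T *\<^sub>v x\<close> ranges over the transformed state space and
  \<open>T *\<^sub>v f x u\<close> is its successor.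
\<close>

definition CAP_form ::
  "nat \<Rightarrow> nat \<Rightarrow> real vec set \<Rightarrow> real vec set \<Rightarrow> (real vec \<Rightarrow> real vec \<Rightarrow> real vec) \<Rightarrow> real mat \<Rightarrow> bool" where
  "CAP_form n m X U f T \<longleftrightarrow>
     (\<exists>n1 n2 g h C D.
        n1 + n2 = n \<and>
        g \<in> (\<lambda>x. vec_last (T *\<^sub>v x) n2) ` X \<rightarrow> carrier_vec n1 \<and>
        h \<in> (\<lambda>x. vec_last (T *\<^sub>v x) n2) ` X \<rightarrow> carrier_vec n2 \<and>
        C \<in> carrier_mat n1 n1 \<and> D \<in> carrier_mat n1 m \<and>
        (\<forall>x\<in>X. \<forall>u\<in>U.
           let x1 = vec_first (T *\<^sub>v x) n1; x2 = vec_last (T *\<^sub>v x) n2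
           in T *\<^sub>v f x u = ((g x2 + C *\<^sub>v x1) @\<^sub>v h x2) + (D @\<^sub>r 0\<^sub>m n2 m) *\<^sub>v u))"

lemma vec_coords_carrier: "x \<in> carrier_vec k \<Longrightarrow> vec_coords x = (\<lambda>i. if i < k then x $ i else 0)"
  by (auto simp: vec_coords_def)

lemma open_vec_set_iff:
  "open_vec_set k S \<longleftrightarrow> S \<subseteq> carrier_vec k \<and>
     (\<forall>x\<in>S. \<exists>e>0. \<forall>y\<in>carrier_vec k. (\<forall>i<k. \<bar>y $ i - x $ i\<bar> < e) \<longrightarrow> y \<in> S)"
proof (cases "S \<subseteq> carrier_vec k")
  case False
  then show ?thesis by (simp add: open_vec_set_def)
next
  case S: True
  let ?Z = "{z::nat \<Rightarrow> real. \<forall>i\<ge>k. z i = 0}"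
  have inj: "y = z" if "y \<in> carrier_vec k" "z \<in> carrier_vec k" "vec_coords y = vec_coords z" for y z
  proof (rule eq_vecI)
    show "y $ i = z $ i" if "i < dim_vec z" for i
      using fun_cong[OF \<open>vec_coords y = vec_coords z\<close>, of i] that
        \<open>y \<in> carrier_vec k\<close> \<open>z \<in> carrier_vec k\<close> by (auto simp: vec_coords_def)
  qed (use that in auto)
  have "openin (Euclidean_space k) (vec_coords ` S) \<longleftrightarrow>
     (\<forall>x\<in>S. \<exists>e>0. \<forall>y\<in>carrier_vec k. (\<forall>i<k. \<bar>y $ i - x $ i\<bar> < e) \<longrightarrow> y \<in> S)" (is "?L \<longleftrightarrow> ?R")
  proof
    assume ?L
    then obtain T where T: "openin (powertop_real UNIV) T" "vec_coords ` S = T \<inter> ?Z"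
      by (auto simp: Euclidean_space_def openin_subtopology)
    show ?R
    proof
      fix x assume x: "x \<in> S"
      then have "vec_coords x \<in> T" using T by auto
      then obtain V where V: "\<And>i. open (V i)" "vec_coords x \<in> Pi\<^sub>E UNIV V" "Pi\<^sub>E UNIV V \<subseteq> T"
          "finite {i. V i \<noteq> UNIV}"
        using T(1) unfolding openin_product_topology_alt by force
      have "\<exists>e>0. ball (vec_coords x i) e \<subseteq> V i" for i
        using V(1)[of i] V(2) by (auto simp: open_contains_ball PiE_iff)
      then obtain e where e: "\<And>i. e i > 0" "\<And>i. ball (vec_coords x i) (e i) \<subseteq> V i" by metis
      define d where "d = Min (insert 1 (e ` {..<k}))"
      have d: "d > 0" "\<And>i. i < k \<Longrightarrow> d \<le> e i"
        unfolding d_def using e(1) by (auto intro: Min_le)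
      show "\<exists>e>0. \<forall>y\<in>carrier_vec k. (\<forall>i<k. \<bar>y $ i - x $ i\<bar> < e) \<longrightarrow> y \<in> S"
      proof (intro exI[of _ d] conjI ballI impI)
        fix y assume y: "y \<in> carrier_vec k" and c: "\<forall>i<k. \<bar>y $ i - x $ i\<bar> < d"
        have xk: "x \<in> carrier_vec k" using x S by auto
        have "vec_coords y i \<in> V i" for i
        proof (cases "i < k")
          case True
          then have "vec_coords y i \<in> ball (vec_coords x i) (e i)"
            using c d(2)[OF True] xk y by (force simp: vec_coords_carrier dist_real_def)
          then show ?thesis using e(2) by blast
        next
          case False
          then have "vec_coords y i = vec_coords x i" using xk y by (simp add: vec_coords_carrier)
          then show ?thesis using V(2) by (auto simp: PiE_iff)
        qed
        then have "vec_coords y \<in> T" using V(3) by (auto simp: PiE_iff)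
        moreover have "vec_coords y \<in> ?Z" using y by (simp add: vec_coords_carrier)
        ultimately have "vec_coords y \<in> vec_coords ` S" using T(2) by blast
        then show "y \<in> S" using inj y S by blast
      qed (rule d)
    qed
  next
    assume R: ?R
    define T where "T = {z. (vec (k::nat) z :: real vec) \<in> S}"
    have "openin (powertop_real UNIV) T"
      unfolding openin_product_topology_alt
    proof (intro conjI ballI)
      fix z assume "z \<in> T"
      then obtain e where e: "e > 0"
        "\<And>y. y \<in> carrier_vec k \<Longrightarrow> (\<forall>i<k. \<bar>y $ i - z i\<bar> < e) \<Longrightarrow> y \<in> S"
        using R by (fastforce simp: T_def)
      let ?V = "\<lambda>i. if i < k then ball (z i) e else UNIV"
      have "finite {i \<in> UNIV. ?V i \<noteq> topspace euclideanreal}"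
        by (rule finite_subset[of _ "{..<k}"]) auto
      moreover have "\<forall>i\<in>UNIV. openin euclideanreal (?V i)" by auto
      moreover have "z \<in> Pi\<^sub>E UNIV ?V" using e(1) by auto
      moreover have "Pi\<^sub>E UNIV ?V \<subseteq> T"
      proof
        fix w assume "w \<in> Pi\<^sub>E UNIV ?V"
        then have "\<bar>w i - z i\<bar> < e" if "i < k" for i
          using that by (auto simp: PiE_iff dist_real_def abs_minus_commute dest!: spec[of _ i])
        then show "w \<in> T" unfolding T_def by (auto intro!: e(2))
      qed
      ultimately show "\<exists>V. finite {i \<in> UNIV. V i \<noteq> topspace euclideanreal} \<and>
          (\<forall>i\<in>UNIV. openin euclideanreal (V i)) \<and> z \<in> Pi\<^sub>E UNIV V \<and> Pi\<^sub>E UNIV V \<subseteq> T"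
        by (intro exI[of _ ?V] conjI)
    qed
    moreover have "vec_coords ` S = T \<inter> ?Z"
    proof (intro equalityI subsetI)
      fix z assume "z \<in> vec_coords ` S"
      then obtain x where x: "x \<in> S" "z = vec_coords x" by auto
      then have xk: "x \<in> carrier_vec k" using S by auto
      then have "vec k z = x" using x by (auto simp: vec_coords_carrier)
      then show "z \<in> T \<inter> ?Z" using x xk by (simp add: T_def vec_coords_carrier)
    next
      fix z assume z: "z \<in> T \<inter> ?Z"
      then have "z = vec_coords (vec k z)" by (auto simp: vec_coords_def)
      then show "z \<in> vec_coords ` S" using z by (auto simp: T_def)
    qed
    ultimately show ?L
      by (auto simp: Euclidean_space_def openin_subtopology)
  qed
  then show ?thesis using S by (simp add: open_vec_set_def)
qed

end

theory Submission
  imports Defs "Jordan_Normal_Form.Determinant"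
begin

text \<open>
  Let \<open>B k\<close> be the input matrix of the \<open>k\<close>-step predictor and \<open>R k\<close> its column space, with
  \<open>R 0 = 0\<close>. Every \<open>y \<in> X\<close> is reached in \<open>k\<close> steps with inputs from the open set \<open>U\<close>, so
  perturbing these inputs moves \<open>y\<close> along all small vectors \<open>B k v\<close>; comparing the \<open>k\<close>-step with
  the \<open>(k + 1)\<close>-step predictor shows that there \<open>f\<close> changes by the linear term
  \<open>B (k + 1) (v, 0)\<close>, which does not depend on \<open>y\<close>. By convexity of \<open>X\<close> this local statement holds
  whenever \<open>y\<close> and \<open>y + B k v\<close> both lie in \<open>X\<close>. Delaying the inputs by one step gives
  \<open>R k \<subseteq> R (k + 1)\<close>, and for reasons of dimension \<open>R k = R (k + 1)\<close> for some \<open>k \<le> n\<close>. This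
  subspace contains the range of \<open>B 1\<close>, is mapped into itself by the linear part of \<open>f\<close> along it,
  and is taken to the first block of coordinates by a matrix \<open>T\<close> bringing \<open>B k\<close> to reduced row
  echelon form. Conversely, in CAP form the second block evolves autonomously, so the inputs enter
  the first block linearly after any number of steps.
\<close>

section \<open>Vectors and matrices\<close>

lemma invertible_mat_obtain_inverse:
  assumes "T \<in> carrier_mat n n" "invertible_mat T"
  obtains T' where "T' \<in> carrier_mat n n" "T * T' = 1\<^sub>m n" "T' * T = 1\<^sub>m n"
proof -
  obtain T' where T': "T * T' = 1\<^sub>m n" "T' * T = 1\<^sub>m (dim_row T')"
    using assms by (auto simp: invertible_mat_def inverts_mat_def)
  have "dim_col T' = n" "dim_row T' = n"
    using arg_cong[OF T'(1), of dim_col] arg_cong[OF T'(2), of dim_col] assms(1) by auto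
  then show thesis using T' that[of T'] by auto
qed

lemma mult_mat_vec_in_carrier: "A \<in> carrier_mat r c \<Longrightarrow> A *\<^sub>v v \<in> carrier_vec r"
  by (rule carrier_vecI) auto

lemma zero_mat_mult_vec:
  fixes v :: "'a :: semiring_0 vec"
  assumes "v \<in> carrier_vec c"
  shows "0\<^sub>m r c *\<^sub>v v = 0\<^sub>v r"
  using assms by (intro eq_vecI) auto

lemma add_vec_eq_selfD:
  fixes v w :: "'a :: cancel_comm_monoid_add vec"
  assumes "v + w = v" "v \<in> carrier_vec r" "w \<in> carrier_vec r"
  shows "w = 0\<^sub>v r"
proof (rule eq_vecI)
  fix i assume "i < dim_vec (0\<^sub>v r :: 'a vec)"
  then show "w $ i = 0\<^sub>v r $ i" using arg_cong[OF assms(1), of "\<lambda>z. z $ i"] assms(2,3) by simp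
qed (use assms in simp)

text \<open>The matrix is the normal form of \<open>column_space_normal_form\<close>; through it a
  vector with vanishing second block is traced back to the columns of \<open>M\<close>.\<close>

lemma vec_last_0_decomp:
  fixes v :: "'a :: semiring_1 vec"
  assumes "v \<in> carrier_vec (n1 + n2)" "vec_last v n2 = 0\<^sub>v n2"
  shows "v = (1\<^sub>m n1 @\<^sub>r 0\<^sub>m n2 n1) *\<^sub>v vec_first v n1"
proof -
  have "v = vec_first v n1 @\<^sub>v 0\<^sub>v n2"
    using vec_first_last_append[OF assms(1)] assms(2) by simp
  also have "\<dots> = (1\<^sub>m n1 @\<^sub>r 0\<^sub>m n2 n1) *\<^sub>v vec_first v n1"
    by (subst mat_mult_append) (auto simp: zero_mat_mult_vec)
  finally show ?thesis .
qed

lemma vec_first_add: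
  assumes "v \<in> carrier_vec (n1 + n2)" "w \<in> carrier_vec (n1 + n2)"
  shows "vec_first (v + w) n1 = vec_first v n1 + vec_first w n1"
  using assms by (intro eq_vecI) (auto simp: vec_first_def)

lemma vec_last_add:
  assumes "v \<in> carrier_vec (n1 + n2)" "w \<in> carrier_vec (n1 + n2)"
  shows "vec_last (v + w) n2 = vec_last v n2 + vec_last w n2"
  using assms by (intro eq_vecI) (auto simp: vec_last_def)

lemma vec_first_append:
  assumes "v \<in> carrier_vec n1"
  shows "vec_first (v @\<^sub>v w) n1 = v"
  using assms by (intro eq_vecI) (auto simp: vec_first_def)

lemma vec_last_append:
  assumes "w \<in> carrier_vec n2"
  shows "vec_last (v @\<^sub>v w) n2 = w"
  using assms by (intro eq_vecI) (auto simp: vec_last_def)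

text \<open>The block row \<open>[A B]\<close>, realised as a four-block matrix with empty lower
  blocks. It attaches the columns of one more input to a predictor matrix.\<close>

lemma exists_mat_append_cols:
  fixes A B :: "'a :: semiring_0 mat"
  assumes "A \<in> carrier_mat nr nc1" "B \<in> carrier_mat nr nc2"
  obtains E where "E \<in> carrier_mat nr (nc1 + nc2)"
    "\<And>v w. v \<in> carrier_vec nc1 \<Longrightarrow> w \<in> carrier_vec nc2 \<Longrightarrow> E *\<^sub>v (v @\<^sub>v w) = A *\<^sub>v v + B *\<^sub>v w"
proof (rule that)
  let ?E = "four_block_mat A B (0\<^sub>m 0 nc1) (0\<^sub>m 0 nc2)"
  show "?E \<in> carrier_mat nr (nc1 + nc2)" using assms by auto
  fix v w :: "'a :: semiring_0 vec" assume vw: "v \<in> carrier_vec nc1" "w \<in> carrier_vec nc2"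
  show "?E *\<^sub>v (v @\<^sub>v w) = A *\<^sub>v v + B *\<^sub>v w"
    by (subst four_block_mat_mult_vec[OF assms _ _ vw]) (use assms vw in \<open>auto intro!: eq_vecI\<close>)
qed

lemma vec_first_mult_mat:
  fixes M :: "'a :: semiring_0 mat"
  assumes "M \<in> carrier_mat (n1 + n2) c"
  obtains C where "C \<in> carrier_mat n1 c"
    "\<And>v. v \<in> carrier_vec c \<Longrightarrow> vec_first (M *\<^sub>v v) n1 = C *\<^sub>v v"
proof (rule that)
  let ?C = "mat n1 c (\<lambda>(i, j). M $$ (i, j))"
  show "?C \<in> carrier_mat n1 c" by simp
  fix v :: "'a :: semiring_0 vec" assume "v \<in> carrier_vec c"
  then show "vec_first (M *\<^sub>v v) n1 = ?C *\<^sub>v v"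
    using assms by (intro eq_vecI) (auto simp: vec_first_def scalar_prod_def)
qed

text \<open>Gauss-Jordan elimination is left multiplication by an invertible \<open>T\<close>. The
  rank of \<open>M\<close> is \<open>n1\<close>, the matrix \<open>S\<close> selects the pivot
  columns of \<open>T * M\<close>, and the last \<open>n2\<close> rows of \<open>T * M\<close>
  vanish.\<close>

lemma column_space_normal_form:
  fixes M :: "'a :: field mat"
  assumes M: "M \<in> carrier_mat n c"
  obtains n1 n2 T S where "n1 + n2 = n" "T \<in> carrier_mat n n" "invertible_mat T"
    "S \<in> carrier_mat c n1" "T * M * S = 1\<^sub>m n1 @\<^sub>r 0\<^sub>m n2 n1"
    "\<And>v. v \<in> carrier_vec c \<Longrightarrow> vec_last (T *\<^sub>v (M *\<^sub>v v)) n2 = 0\<^sub>v n2"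
proof -
  obtain A B where AB: "gauss_jordan M (0\<^sub>m n 0) = (A, B)" by fastforce
  have A: "A \<in> carrier_mat n c" using gauss_jordan_carrier(1)[OF M zero_carrier_mat AB] .
  obtain T where TU: "T \<in> Units (ring_mat TYPE('a) n ())" and AT: "A = T * M"
    using gauss_jordan_transform[OF M zero_carrier_mat AB, of "()"] by auto
  then obtain T' where T: "T \<in> carrier_mat n n" "T' \<in> carrier_mat n n" "T * T' = 1\<^sub>m n" "T' * T = 1\<^sub>m n"
    by (auto simp: Units_def ring_mat_def)
  then have inv: "invertible_mat T"
    by (auto simp: invertible_mat_def inverts_mat_def)
  obtain p where "pivot_fun A p c"
    using gauss_jordan_row_echelon[OF M AB] A by (auto simp: row_echelon_form_def)
  note piv = pivot_funD[OF carrier_matD(1)[OF A] this]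
  \<comment> \<open>The first row without a pivot, or \<open>n\<close> if there is none; the value
    \<open>c\<close> of \<open>p\<close> marks a zero row.\<close>
  define n1 where "n1 = (LEAST i. i \<ge> n \<or> p i = c)"
  have ex: "n1 \<ge> n \<or> p n1 = c" unfolding n1_def by (rule LeastI[of _ n]) simp
  have n1_le: "n1 \<le> n" unfolding n1_def by (rule Least_le) simp
  have small: "i < n \<and> p i \<noteq> c" if "i < n1" for i
    using not_less_Least[of i "\<lambda>i. i \<ge> n \<or> p i = c"] that by (auto simp: n1_def)
  have small': "p i < c" if "i < n1" for i using small[OF that] piv(1)[of i] by simp
  have big: "p i = c" if "n1 \<le> i" "i < n" for i
    using that
  proof (induction i rule: dec_induct)
    case base then show ?case using ex by auto
  next
    case (step j)
    then have "p j = c" "p (Suc j) \<le> c" using piv(1)[of "Suc j"] by auto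
    then show ?case using piv(3)[of j] step by auto
  qed
  define n2 where "n2 = n - n1"
  have n: "n1 + n2 = n" using n1_le by (simp add: n2_def)
  define S where "S = mat c n1 (\<lambda>(i, j). if i = p j then 1 else 0 :: 'a)"
  have S: "S \<in> carrier_mat c n1" by (simp add: S_def)
  \<comment> \<open>The pivot columns of a reduced row echelon form are the first \<open>n1\<close>
    unit vectors.\<close>
  have "A * S = 1\<^sub>m n1 @\<^sub>r 0\<^sub>m n2 n1"
  proof (rule eq_matI)
    fix i j assume "i < dim_row (1\<^sub>m n1 @\<^sub>r 0\<^sub>m n2 n1 :: 'a mat)" "j < dim_col (1\<^sub>m n1 @\<^sub>r 0\<^sub>m n2 n1 :: 'a mat)"
    then have ij: "i < n" "j < n1" using n by (auto simp: append_rows_def)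
    have "(A * S) $$ (i, j) = (\<Sum>k<c. A $$ (i, k) * (if k = p j then 1 else 0))"
      using ij A S by (simp add: scalar_prod_def S_def lessThan_atLeast0)
    also have "\<dots> = A $$ (i, p j)"
      using small'[OF ij(2)] by (simp add: if_distrib[of "\<lambda>x. _ * x"] cong: if_cong)
    also have "\<dots> = (if i = j then 1 else 0)"
      using piv(4,5)[of j] ij small[of j] small'[of j] by auto
    also have "\<dots> = (1\<^sub>m n1 @\<^sub>r 0\<^sub>m n2 n1) $$ (i, j)" using ij n by (auto simp: append_rows_def)
    finally show "(A * S) $$ (i, j) = (1\<^sub>m n1 @\<^sub>r 0\<^sub>m n2 n1) $$ (i, j)" .
  qed (use A S n in \<open>auto simp: append_rows_def\<close>)
  moreover have "vec_last (T *\<^sub>v (M *\<^sub>v v)) n2 = 0\<^sub>v n2" if v: "v \<in> carrier_vec c" for v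
  proof -
    have "T *\<^sub>v (M *\<^sub>v v) = A *\<^sub>v v" unfolding AT using T M v by (simp add: assoc_mult_mat_vec)
    moreover have "(A *\<^sub>v v) $ (n1 + i) = 0" if "i < n2" for i
      using that n A v piv(2)[of "n1 + i"] big[of "n1 + i"] by (simp add: scalar_prod_def)
    ultimately show ?thesis using A n by (intro eq_vecI) (auto simp: vec_last_def n2_def)
  qed
  ultimately show thesis using that[OF n T(1) inv S] AT by simp
qed

text \<open>Were all \<open>n + 1\<close> inclusions strict, the dimension would grow beyond
  \<open>n\<close>.\<close>

lemma subspace_chain_stabilises:
  fixes R :: "nat \<Rightarrow> 'a :: field vec set"
  assumes carr: "\<And>k. R k \<subseteq> carrier_vec n"
    and zero: "\<And>k. 0\<^sub>v n \<in> R k"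
    and add: "\<And>k v w. v \<in> R k \<Longrightarrow> w \<in> R k \<Longrightarrow> v + w \<in> R k"
    and smult: "\<And>k a v. v \<in> R k \<Longrightarrow> a \<cdot>\<^sub>v v \<in> R k"
    and mono: "\<And>k. k \<le> n \<Longrightarrow> R k \<subseteq> R (Suc k)"
  obtains k where "k \<le> n" "R (Suc k) = R k"
proof (rule ccontr)
  assume "\<not> thesis"
  then have "\<forall>k\<in>{..n}. \<exists>w. w \<in> R (Suc k) \<and> w \<notin> R k" using that mono by blast
  then obtain w where w: "\<And>k. k \<le> n \<Longrightarrow> w k \<in> R (Suc k)" "\<And>k. k \<le> n \<Longrightarrow> w k \<notin> R k"
    by (metis atMost_iff)
  have wc: "w k \<in> carrier_vec n" if "k \<le> n" for k using w(1)[OF that] carr by blast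
  \<comment> \<open>The \<open>n + 1\<close> vectors \<open>w 0, \<dots>, w n\<close> of dimension \<open>n\<close> are linearly dependent, as the square matrix
    with these columns padded by a zero row is singular; the last vector with a nonzero coefficient
    \<open>c $ j\<close> then lies in \<open>R j\<close>.\<close>
  define r where "r i = vec (Suc n) (\<lambda>j. w j $ i)" for i
  define A where "A = mat\<^sub>r (Suc n) (Suc n) (\<lambda>i. if i = n then 0\<^sub>v (Suc n) else r i)"
  have "det A = 0" unfolding A_def by (rule det_row_0) (auto simp: r_def)
  then obtain c where c: "c \<in> carrier_vec (Suc n)" "c \<noteq> 0\<^sub>v (Suc n)" "A *\<^sub>v c = 0\<^sub>v (Suc n)"
    using det_0_iff_vec_prod_zero_field[of A "Suc n"] by (auto simp: A_def)
  \<comment> \<open>Partial sums of the dependence relation: \<open>s j\<close> involves only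
    \<open>w l\<close> with \<open>l < j\<close>, hence lies in \<open>R j\<close>, and
    \<open>s (Suc n)\<close> is the whole relation, so zero.\<close>
  define s where "s j = vec n (\<lambda>i. \<Sum>l<j. w l $ i * c $ l)" for j
  have s_Suc: "s (Suc j) = s j + c $ j \<cdot>\<^sub>v w j" if "j \<le> n" for j
    using wc[OF that] by (intro eq_vecI) (auto simp: s_def)
  have sR: "s j \<in> R j" if "j \<le> Suc n" for j
    using that
  proof (induction j)
    case 0
    have "s 0 = 0\<^sub>v n" by (auto simp: s_def)
    then show ?case using zero by simp
  next
    case (Suc j)
    then show ?case using s_Suc[of j] add smult w(1)[of j] mono[of j] by auto
  qed
  have "s (Suc n) = 0\<^sub>v n"
  proof (rule eq_vecI)
    fix i assume "i < dim_vec (0\<^sub>v n :: 'a vec)"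
    then have i: "i < n" by simp
    then have "(A *\<^sub>v c) $ i = r i \<bullet> c" by (simp add: A_def r_def)
    also have "\<dots> = s (Suc n) $ i"
      using i c(1) by (simp add: r_def s_def scalar_prod_def lessThan_atLeast0)
    finally show "s (Suc n) $ i = 0\<^sub>v n $ i" using c(3) i by simp
  qed (simp add: s_def)
  \<comment> \<open>The coefficients are removed from the top: if \<open>c $ j\<close> were nonzero,
    \<open>w j\<close> would be a multiple of \<open>s j\<close> and so lie in
    \<open>R j\<close>.\<close>
  moreover have "s j = 0\<^sub>v n \<Longrightarrow> j \<le> Suc n \<Longrightarrow> \<forall>l<j. c $ l = 0" for j
  proof (induction j)
    case (Suc j)
    then have j: "j \<le> n" and sj: "s j + c $ j \<cdot>\<^sub>v w j = 0\<^sub>v n" using s_Suc by auto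
    have cj: "c $ j = 0"
    proof (rule ccontr)
      assume nz: "c $ j \<noteq> 0"
      have "w j = (- 1 / c $ j) \<cdot>\<^sub>v s j"
      proof (rule eq_vecI)
        fix i assume "i < dim_vec ((- 1 / c $ j) \<cdot>\<^sub>v s j)"
        then have i: "i < n" by (simp add: s_def)
        then have "s j $ i + c $ j * w j $ i = 0"
          using arg_cong[OF sj, of "\<lambda>v. v $ i"] wc[OF j] by simp
        then show "w j $ i = ((- 1 / c $ j) \<cdot>\<^sub>v s j) $ i"
          using nz i by (simp add: s_def field_simps eq_neg_iff_add_eq_0)
      qed (use wc[OF j] in \<open>simp add: s_def\<close>)
      then show False using w(2)[OF j] smult[OF sR[of j]] j by simp
    qed
    have "0 \<cdot>\<^sub>v w j = 0\<^sub>v n" using wc[OF j] by (intro eq_vecI) auto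
    then have "s j = 0\<^sub>v n" using sj cj by (simp add: s_def)
    then show ?case using Suc cj j by (auto simp: less_Suc_eq)
  qed simp
  ultimately have "\<forall>l<Suc n. c $ l = 0" by simp
  then have "c = 0\<^sub>v (Suc n)" using c(1) by (intro eq_vecI) auto
  then show False using c(2) by contradiction
qed

section \<open>Trajectories and predictors\<close>

lemma state_Suc_shift:
  "state f x u (Suc N) = state f (f x (u 0)) (\<lambda>t. u (Suc t)) N"
  by (induction N) auto

lemma state_cong:
  "(\<And>t. t < N \<Longrightarrow> u t = u' t) \<Longrightarrow> state f x u N = state f x u' N"
  by (induction N) auto

lemma stack_cong:
  "(\<And>t. t < N \<Longrightarrow> u t = u' t) \<Longrightarrow> stack u N = stack u' N"
  by (induction N) auto

lemma stack_carrier: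
  "(\<And>t. t < N \<Longrightarrow> u t \<in> carrier_vec m) \<Longrightarrow> stack u N \<in> carrier_vec (N * m)"
proof (induction N)
  case (Suc N)
  then have "stack u N @\<^sub>v u N \<in> carrier_vec (N * m + m)" by (intro append_carrier_vec) auto
  then show ?case by (simp add: add.commute)
qed simp

lemma stack_Suc_shift:
  "stack u (Suc N) = u 0 @\<^sub>v stack (\<lambda>t. u (Suc t)) N"
proof (induction N)
  case 0
  show ?case by (intro eq_vecI) auto
next
  case (Suc N)
  have "(u 0 @\<^sub>v v) @\<^sub>v w = u 0 @\<^sub>v v @\<^sub>v w" for v w
    by (intro eq_vecI) auto
  then show ?case using Suc by (metis stack.simps(2))
qed

text \<open>Block \<open>t\<close> starts at index \<open>t * m\<close>; cutting a vector into these
  blocks is inverse to stacking.\<close>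

lemma stack_slices:
  "stack (\<lambda>t. vec m (\<lambda>i. v $ (t * m + i))) N = vec (N * m) (\<lambda>i. v $ i)"
proof (induction N)
  case (Suc N)
  then show ?case by (intro eq_vecI) auto
qed (auto intro: eq_vecI)

lemma exists_stack_eq:
  assumes "v \<in> carrier_vec (N * m)"
  obtains u where "\<And>t. u t \<in> carrier_vec m" "stack u N = v"
proof (rule that)
  show "stack (\<lambda>t. vec m (\<lambda>i. v $ (t * m + i))) N = v"
    unfolding stack_slices using assms by (intro eq_vecI) auto
qed simp

lemma stack_add_smult:
  assumes "\<And>t. t < N \<Longrightarrow> a t \<in> carrier_vec m" "\<And>t. t < N \<Longrightarrow> b t \<in> carrier_vec m"
  shows "stack (\<lambda>t. a t + d \<cdot>\<^sub>v b t) N = stack a N + d \<cdot>\<^sub>v stack b N"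
  using assms
proof (induction N)
  case (Suc N)
  have "stack a N \<in> carrier_vec (N * m)" "stack b N \<in> carrier_vec (N * m)"
    using Suc.prems by (auto intro!: stack_carrier)
  moreover have "a N \<in> carrier_vec m" "b N \<in> carrier_vec m" using Suc.prems by auto
  moreover have "stack (\<lambda>t. a t + d \<cdot>\<^sub>v b t) N = stack a N + d \<cdot>\<^sub>v stack b N"
    using Suc by simp
  ultimately show ?case by (intro eq_vecI) auto
qed (auto intro: eq_vecI)

text \<open>The filter \<open>nhds 0\<close> replaces an explicit radius, so that conditions on
  finitely many inputs combine and can later be shifted along a segment.\<close>

lemma eventually_perturbation_in_open:
  assumes "open_vec_set m U" "u \<in> U" "v \<in> carrier_vec m"
  shows "\<forall>\<^sub>F d in nhds 0. u + d \<cdot>\<^sub>v v \<in> U"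
proof -
  have u: "u \<in> carrier_vec m" using assms by (auto simp: open_vec_set_iff)
  obtain e where e: "e > 0" "\<And>y. y \<in> carrier_vec m \<Longrightarrow> (\<forall>i<m. \<bar>y $ i - u $ i\<bar> < e) \<Longrightarrow> y \<in> U"
    using assms by (auto simp: open_vec_set_iff)
  have "\<forall>\<^sub>F d in nhds 0. \<bar>d * v $ i\<bar> < e" for i
  proof (rule order_tendstoD)
    show "((\<lambda>d. \<bar>d * v $ i\<bar>) \<longlongrightarrow> \<bar>0 * v $ i\<bar>) (nhds 0)"
      by (intro tendsto_intros filterlim_ident)
  qed (use e in simp)
  then have "\<forall>\<^sub>F d in nhds 0. \<forall>i\<in>{..<m}. \<bar>d * v $ i\<bar> < e"
    by (intro eventually_ball_finite) auto
  then show ?thesis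
  proof eventually_elim
    case (elim d)
    show ?case by (rule e(2)) (use elim u assms(3) in auto)
  qed
qed

section \<open>Trajectories of a surjective system\<close>

locale surjective_system =
  fixes n m :: nat and X U :: "real vec set" and f :: "real vec \<Rightarrow> real vec \<Rightarrow> real vec"
  assumes open_X: "open_vec_set n X" and convex_X: "convex_vec_set X"
    and open_U: "open_vec_set m U"
    and surj: "(\<lambda>(x, u). f x u) ` (X \<times> U) = X"
begin

lemma X_carrier: "x \<in> X \<Longrightarrow> x \<in> carrier_vec n"
  using open_X by (auto simp: open_vec_set_iff)

lemma U_carrier: "u \<in> U \<Longrightarrow> u \<in> carrier_vec m"
  using open_U by (auto simp: open_vec_set_iff)

lemma f_in: "x \<in> X \<Longrightarrow> u \<in> U \<Longrightarrow> f x u \<in> X"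
  using surj by force

lemma surjE:
  assumes "y \<in> X"
  obtains x u where "x \<in> X" "u \<in> U" "f x u = y"
  using assms surj by force

lemma state_in: "x \<in> X \<Longrightarrow> (\<And>t. t < N \<Longrightarrow> u t \<in> U) \<Longrightarrow> state f x u N \<in> X"
  by (induction N) (auto intro: f_in)

text \<open>By surjectivity the initial state of a trajectory has a predecessor, which is prepended;
  \<open>case_nat\<close> puts its input first.\<close>

lemma reachable:
  assumes "y \<in> X"
  shows "\<exists>x\<in>X. \<exists>u. (\<forall>t. u t \<in> U) \<and> state f x u k = y"
proof (induction k)
  case 0
  obtain u where "u \<in> U" using surjE[OF assms] by blast
  then show ?case using assms by (intro bexI[of _ y] exI[of _ "\<lambda>_. u"]) auto
next
  case (Suc k)
  then obtain x u where x: "x \<in> X" "\<forall>t. u t \<in> U" "state f x u k = y" by blast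
  obtain x0 u0 where x0: "x0 \<in> X" "u0 \<in> U" "f x0 u0 = x" using surjE[OF x(1)] .
  have "state f x0 (case_nat u0 u) (Suc k) = y"
    unfolding state_Suc_shift using x x0 by simp
  moreover have "\<forall>t. case_nat u0 u t \<in> U" using x x0 by (auto split: nat.split)
  ultimately show ?case using x0(1) by blast
qed

section \<open>Predictors and perturbed inputs\<close>

definition predictor :: "nat \<Rightarrow> (real vec \<Rightarrow> real vec) \<Rightarrow> real mat \<Rightarrow> bool" where
  "predictor N \<Phi> B \<longleftrightarrow> \<Phi> \<in> X \<rightarrow> carrier_vec n \<and> B \<in> carrier_mat n (N * m) \<and>
       (\<forall>x\<in>X. \<forall>u. (\<forall>t<N. u t \<in> U) \<longrightarrow> state f x u N = \<Phi> x + B *\<^sub>v stack u N)"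

lemma linear_predictor_iff: "linear_predictor n m X U f N \<longleftrightarrow> (\<exists>\<Phi> B. predictor N \<Phi> B)"
  by (simp add: linear_predictor_def predictor_def)

text \<open>The input matrix has no columns, so its column space is zero: the start of the chain of
  subspaces.\<close>

lemma predictor_0: "predictor 0 (\<lambda>x. x) (0\<^sub>m n 0)"
  by (auto simp: predictor_def zero_mat_mult_vec dest: X_carrier)

lemma predictor_carrier: "predictor N \<Phi> B \<Longrightarrow> B \<in> carrier_mat n (N * m)"
  by (simp add: predictor_def)

text \<open>The term \<open>\<Phi> x\<close> is common to both input sequences, so the final states
  differ only by \<open>B\<close> applied to the stacked perturbation.\<close>

lemma predictor_perturb:
  assumes P: "predictor N \<Phi> B" and x: "x \<in> X"
    and a: "\<And>t. t < N \<Longrightarrow> a t \<in> U" and b: "\<And>t. t < N \<Longrightarrow> b t \<in> carrier_vec m"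
    and ab: "\<And>t. t < N \<Longrightarrow> a t + d \<cdot>\<^sub>v b t \<in> U"
  shows "state f x (\<lambda>t. a t + d \<cdot>\<^sub>v b t) N = state f x a N + d \<cdot>\<^sub>v (B *\<^sub>v stack b N)"
proof -
  have B: "B \<in> carrier_mat n (N * m)" and \<Phi>: "\<Phi> x \<in> carrier_vec n"
    using P x by (auto simp: predictor_def)
  have sa: "stack a N \<in> carrier_vec (N * m)" and sb: "stack b N \<in> carrier_vec (N * m)"
    using a b U_carrier by (auto intro!: stack_carrier)
  have "stack (\<lambda>t. a t + d \<cdot>\<^sub>v b t) N = stack a N + d \<cdot>\<^sub>v stack b N"
    using a b by (intro stack_add_smult) (auto intro: U_carrier)
  then have "state f x (\<lambda>t. a t + d \<cdot>\<^sub>v b t) N = \<Phi> x + B *\<^sub>v (stack a N + d \<cdot>\<^sub>v stack b N)"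
    using P x ab by (simp add: predictor_def)
  also have "\<dots> = \<Phi> x + (B *\<^sub>v stack a N + d \<cdot>\<^sub>v (B *\<^sub>v stack b N))"
    using B sa sb by (simp add: mult_add_distrib_mat_vec mult_mat_vec)
  also have "\<dots> = (\<Phi> x + B *\<^sub>v stack a N) + d \<cdot>\<^sub>v (B *\<^sub>v stack b N)"
    using B sa sb \<Phi> by (simp add: assoc_add_vec[of _ n])
  also have "\<Phi> x + B *\<^sub>v stack a N = state f x a N"
    using P x a by (simp add: predictor_def)
  finally show ?thesis .
qed

lemma eventually_inputs_in_U:
  fixes N :: nat
  assumes "\<And>t. t < N \<Longrightarrow> a t \<in> U" "\<And>t. t < N \<Longrightarrow> b t \<in> carrier_vec m"
  shows "\<forall>\<^sub>F d in nhds 0. \<forall>t<N. a t + d \<cdot>\<^sub>v b t \<in> U"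
proof -
  have "\<forall>\<^sub>F d in nhds 0. \<forall>t\<in>{..<N}. a t + d \<cdot>\<^sub>v b t \<in> U"
    using assms by (intro eventually_ball_finite ballI eventually_perturbation_in_open[OF open_U]) auto
  then show ?thesis by (rule eventually_mono) auto
qed

text \<open>Perturbing inputs that lead to \<open>y\<close> in \<open>k\<close> steps moves
  \<open>y\<close> along \<open>B *\<^sub>v v\<close>, while the next predictor describes the image
  under \<open>f\<close>. The increment depends on \<open>B'\<close> and \<open>v\<close> alone,
  whatever trajectory leads to \<open>y\<close>.\<close>

lemma eventually_affine_along_predictor:
  assumes P: "predictor k \<Phi> B" and P': "predictor (Suc k) \<Phi>' B'"
    and y: "y \<in> X" and v: "v \<in> carrier_vec (k * m)" and u: "u \<in> U"
  shows "\<forall>\<^sub>F d in nhds 0. f (y + d \<cdot>\<^sub>v (B *\<^sub>v v)) u = f y u + d \<cdot>\<^sub>v (B' *\<^sub>v (v @\<^sub>v 0\<^sub>v m))"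
proof -
  obtain x us where x: "x \<in> X" "\<And>t. us t \<in> U" "state f x us k = y"
    using reachable[OF y] by blast
  obtain vs where vs: "\<And>t. vs t \<in> carrier_vec m" "stack vs k = v"
    using exists_stack_eq[OF v] by metis
  \<comment> \<open>The last input is \<open>u\<close> and stays unperturbed, so the perturbed state
    \<open>k + 1\<close> is \<open>f\<close> with input \<open>u\<close> at the perturbed state
    \<open>k\<close>.\<close>
  define a where "a = us(k := u)"
  define b where "b = vs(k := 0\<^sub>v m)"
  have a: "a t \<in> U" and b: "b t \<in> carrier_vec m" for t
    using x u vs by (auto simp: a_def b_def)
  have sa: "state f x a k = y"
    using state_cong[of k a us f x] x(3) by (simp add: a_def)
  have sb: "stack b k = v" "stack b (Suc k) = v @\<^sub>v 0\<^sub>v m"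
    using stack_cong[of k b vs] vs by (simp_all add: b_def)
  have "\<forall>\<^sub>F d in nhds 0. \<forall>t<Suc k. a t + d \<cdot>\<^sub>v b t \<in> U"
    using a b by (intro eventually_inputs_in_U)
  then show ?thesis
  proof eventually_elim
    case (elim d)
    have "state f x (\<lambda>t. a t + d \<cdot>\<^sub>v b t) k = y + d \<cdot>\<^sub>v (B *\<^sub>v v)"
      using predictor_perturb[OF P x(1), of a b d] a b elim sa sb by simp
    moreover have "a k + d \<cdot>\<^sub>v b k = u" using U_carrier[OF u] by (auto simp: a_def b_def)
    moreover have "state f x (\<lambda>t. a t + d \<cdot>\<^sub>v b t) (Suc k) = f y u + d \<cdot>\<^sub>v (B' *\<^sub>v (v @\<^sub>v 0\<^sub>v m))"
      using predictor_perturb[OF P' x(1), of a b d] a b elim sa sb by (simp add: a_def)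
    ultimately show ?case by simp
  qed
qed

text \<open>By convexity the segment from \<open>y\<close> to \<open>y + B *\<^sub>v v\<close> lies
  in \<open>X\<close>, and the local statement applies at each of its points.\<close>

lemma affine_along_predictor:
  assumes P: "predictor k \<Phi> B" and P': "predictor (Suc k) \<Phi>' B'"
    and y: "y \<in> X" and v: "v \<in> carrier_vec (k * m)" and u: "u \<in> U"
    and yv: "y + B *\<^sub>v v \<in> X"
  shows "f (y + B *\<^sub>v v) u = f y u + B' *\<^sub>v (v @\<^sub>v 0\<^sub>v m)"
proof -
  define p where "p = B *\<^sub>v v"
  define q where "q = B' *\<^sub>v (v @\<^sub>v 0\<^sub>v m)"
  have p: "p \<in> carrier_vec n" and q: "q \<in> carrier_vec n"
    unfolding p_def q_def
    by (rule mult_mat_vec_in_carrier[OF predictor_carrier[OF P]] mult_mat_vec_in_carrier[OF predictor_carrier[OF P']])+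
  have yc: "y \<in> carrier_vec n" using X_carrier y by simp
  have seg: "y + s \<cdot>\<^sub>v p \<in> X" if "s \<in> {0..1}" for s
  proof -
    have "y + s \<cdot>\<^sub>v p = (1 - s) \<cdot>\<^sub>v y + s \<cdot>\<^sub>v (y + p)"
      using yc p by (intro eq_vecI) (auto simp: algebra_simps)
    also have "\<dots> \<in> X" using convex_X y yv that by (auto simp: convex_vec_set_def p_def)
    finally show ?thesis .
  qed
  \<comment> \<open>Subtracting the predicted linear growth makes the local statement say that
    \<open>\<psi>\<close> is locally constant, hence constant, on \<open>[0, 1]\<close>.\<close>
  define \<psi> where "\<psi> s = f (y + s \<cdot>\<^sub>v p) u - s \<cdot>\<^sub>v q" for s
  have "\<psi> 0 = \<psi> 1"
  proof (rule connected_local_const[of "{0..1::real}"])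
    show "\<forall>s\<in>{0..1}. \<forall>\<^sub>F s' in at s within {0..1}. \<psi> s = \<psi> s'"
    proof
      fix s :: real assume s: "s \<in> {0..1}"
      have "\<forall>\<^sub>F d in nhds 0. f (y + s \<cdot>\<^sub>v p + d \<cdot>\<^sub>v p) u = f (y + s \<cdot>\<^sub>v p) u + d \<cdot>\<^sub>v q"
        using eventually_affine_along_predictor[OF P P' seg[OF s] v u] by (simp add: p_def q_def)
      moreover have "filterlim (\<lambda>s'. s' - s) (nhds 0) (at s within {0..1})"
        by (rule tendsto_eq_intros refl | simp)+
      ultimately have "\<forall>\<^sub>F s' in at s within {0..1}.
          f (y + s \<cdot>\<^sub>v p + (s' - s) \<cdot>\<^sub>v p) u = f (y + s \<cdot>\<^sub>v p) u + (s' - s) \<cdot>\<^sub>v q"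
        by (rule eventually_compose_filterlim)
      then show "\<forall>\<^sub>F s' in at s within {0..1}. \<psi> s = \<psi> s'"
      proof eventually_elim
        case (elim s')
        have "y + s \<cdot>\<^sub>v p + (s' - s) \<cdot>\<^sub>v p = y + s' \<cdot>\<^sub>v p"
          using yc p by (intro eq_vecI) (auto simp: algebra_simps)
        with elim have "f (y + s' \<cdot>\<^sub>v p) u = f (y + s \<cdot>\<^sub>v p) u + (s' - s) \<cdot>\<^sub>v q" by simp
        moreover have "f (y + s \<cdot>\<^sub>v p) u \<in> carrier_vec n" using X_carrier f_in seg s u by blast
        ultimately show ?case
          using q by (intro eq_vecI) (auto simp: \<psi>_def algebra_simps)
      qed
    qed
  qed auto
  moreover have "y + 0 \<cdot>\<^sub>v p = y" "y + 1 \<cdot>\<^sub>v p = y + p" using yc p by auto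
  ultimately have *: "f y u - 0 \<cdot>\<^sub>v q = f (y + p) u - 1 \<cdot>\<^sub>v q" by (simp add: \<psi>_def)
  have c: "f y u \<in> carrier_vec n" "f (y + p) u \<in> carrier_vec n"
    using X_carrier f_in y yv u by (auto simp: p_def)
  have "f (y + p) u = f y u + q"
  proof (rule eq_vecI)
    fix i assume "i < dim_vec (f y u + q)"
    then have i: "i < n" using q by simp
    then show "f (y + p) u $ i = (f y u + q) $ i"
      using arg_cong[OF *, of "\<lambda>w. w $ i"] q c by simp
  qed (use c q in auto)
  then show ?thesis by (simp add: p_def q_def)
qed

text \<open>The same perturbed final state is computed twice: in \<open>k\<close> steps from
  \<open>f x u\<close>, and in \<open>k + 1\<close> steps from \<open>x\<close> with the first input
  unperturbed.\<close>

lemma predictor_tail: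
  assumes P: "predictor k \<Phi> B" and P': "predictor (Suc k) \<Phi>' B'"
    and "X \<noteq> {}" and v: "v \<in> carrier_vec (k * m)"
  shows "B *\<^sub>v v = B' *\<^sub>v (0\<^sub>v m @\<^sub>v v)"
proof -
  obtain x u where x: "x \<in> X" and u: "u \<in> U" using assms(3) surjE by blast
  obtain vs where vs: "\<And>t. vs t \<in> carrier_vec m" "stack vs k = v"
    using exists_stack_eq[OF v] by metis
  define b where "b = case_nat (0\<^sub>v m) vs"
  have b: "b t \<in> carrier_vec m" for t using vs by (auto simp: b_def split: nat.split)
  have "\<forall>\<^sub>F d in nhds 0. \<forall>t<Suc k. u + d \<cdot>\<^sub>v b t \<in> U"
    using u b by (intro eventually_inputs_in_U)
  \<comment> \<open>The punctured filter supplies a nonzero \<open>d\<close>, which is cancelled at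
    the end.\<close>
  then have "\<forall>\<^sub>F d in at 0. d \<noteq> 0 \<and> (\<forall>t<Suc k. u + d \<cdot>\<^sub>v b t \<in> U)"
    by (auto simp: eventually_at_filter elim: eventually_mono)
  then obtain d :: real where d: "d \<noteq> 0" "\<And>t. t < Suc k \<Longrightarrow> u + d \<cdot>\<^sub>v b t \<in> U"
    using eventually_happens[of _ "at (0::real)"] by auto
  have u0: "u + d \<cdot>\<^sub>v b 0 = u" using U_carrier[OF u] by (auto simp: b_def)
  have "state f x (\<lambda>t. u + d \<cdot>\<^sub>v b t) (Suc k) = state f (f x u) (\<lambda>t. u + d \<cdot>\<^sub>v vs t) k"
    unfolding state_Suc_shift u0 by (simp add: b_def)
  also have "\<dots> = state f (f x u) (\<lambda>_. u) k + d \<cdot>\<^sub>v (B *\<^sub>v v)"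
    using predictor_perturb[OF P f_in[OF x u], of "\<lambda>_. u" vs d] u vs d(2)[of "Suc _"]
    by (simp add: b_def)
  also have "state f (f x u) (\<lambda>_. u) k = state f x (\<lambda>_. u) (Suc k)"
    unfolding state_Suc_shift ..
  finally have "state f x (\<lambda>_. u) (Suc k) + d \<cdot>\<^sub>v (B *\<^sub>v v)
      = state f x (\<lambda>_. u) (Suc k) + d \<cdot>\<^sub>v (B' *\<^sub>v stack b (Suc k))"
    using predictor_perturb[OF P' x, of "\<lambda>_. u" b d] u b d(2) by simp
  moreover have "stack b (Suc k) = 0\<^sub>v m @\<^sub>v v"
    unfolding stack_Suc_shift using vs by (simp add: b_def)
  ultimately have *: "state f x (\<lambda>_. u) (Suc k) + d \<cdot>\<^sub>v (B *\<^sub>v v)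
      = state f x (\<lambda>_. u) (Suc k) + d \<cdot>\<^sub>v (B' *\<^sub>v (0\<^sub>v m @\<^sub>v v))" by simp
  have s: "state f x (\<lambda>_. u) (Suc k) \<in> carrier_vec n"
    using X_carrier state_in[OF x, of "Suc k" "\<lambda>_. u"] u by blast
  have B: "dim_row B = n" "dim_row B' = n" using predictor_carrier[OF P] predictor_carrier[OF P'] by auto
  show ?thesis
  proof (rule eq_vecI)
    fix i assume i: "i < dim_vec (B' *\<^sub>v (0\<^sub>v m @\<^sub>v v))"
    then show "(B *\<^sub>v v) $ i = (B' *\<^sub>v (0\<^sub>v m @\<^sub>v v)) $ i"
      using arg_cong[OF *, of "\<lambda>w. w $ i"] s B d(1) by (simp del: state.simps index_mult_mat_vec)
  qed (use B in simp)
qed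

section \<open>Equivalence with the CAP form\<close>

lemma CAP_form_if_linear_predictors:
  assumes pred: "\<forall>N\<in>{1..n + 1}. linear_predictor n m X U f N" and ne: "X \<noteq> {}"
  shows "\<exists>T\<in>carrier_mat n n. invertible_mat T \<and> CAP_form n m X U f T"
proof -
  \<comment> \<open>Adding \<open>N = 0\<close> to the given range lets the chain start from the
    zero space.\<close>
  have "\<exists>\<Phi> B. predictor N \<Phi> B" if "N \<le> Suc n" for N
    using that pred predictor_0 by (cases N) (auto simp: linear_predictor_iff)
  then obtain \<Phi> B where P: "\<And>N. N \<le> Suc n \<Longrightarrow> predictor N (\<Phi> N) (B N)" by metis
  \<comment> \<open>The truncation of the index by \<open>min\<close> makes every \<open>R k\<close> a subspace.\<close>
  define R where "R k = (\<lambda>v. B (min k (Suc n)) *\<^sub>v v) ` carrier_vec (min k (Suc n) * m)" for k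
  note Bc = predictor_carrier[OF P[OF min.cobounded2]]
  have R_carr: "R k \<subseteq> carrier_vec n" for k
    unfolding R_def using mult_mat_vec_in_carrier[OF Bc] by blast
  have R_add: "v + w \<in> R k" if "v \<in> R k" "w \<in> R k" for k v w
  proof -
    obtain a b where a: "a \<in> carrier_vec (min k (Suc n) * m)" "v = B (min k (Suc n)) *\<^sub>v a"
      and b: "b \<in> carrier_vec (min k (Suc n) * m)" "w = B (min k (Suc n)) *\<^sub>v b"
      using \<open>v \<in> R k\<close> \<open>w \<in> R k\<close> by (auto simp: R_def)
    have "v + w = B (min k (Suc n)) *\<^sub>v (a + b)"
      using a b mult_add_distrib_mat_vec[OF Bc] by simp
    then show ?thesis using a(1) b(1) by (auto simp: R_def)
  qed
  have R_smult: "c \<cdot>\<^sub>v v \<in> R k" if "v \<in> R k" for k c v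
  proof -
    obtain a where a: "a \<in> carrier_vec (min k (Suc n) * m)" "v = B (min k (Suc n)) *\<^sub>v a"
      using \<open>v \<in> R k\<close> by (auto simp: R_def)
    then have "c \<cdot>\<^sub>v v = B (min k (Suc n)) *\<^sub>v (c \<cdot>\<^sub>v a)"
      using mult_mat_vec[OF Bc] by simp
    then show ?thesis using a(1) by (auto simp: R_def)
  qed
  have R_zero: "0\<^sub>v n \<in> R k" for k
  proof -
    have "B (min k (Suc n)) *\<^sub>v 0\<^sub>v (min k (Suc n) * m) = 0\<^sub>v n"
      using Bc[of k] by (intro eq_vecI) auto
    then show ?thesis unfolding R_def by (metis imageI zero_carrier_vec)
  qed
  have R_mono: "R k \<subseteq> R (Suc k)" if "k \<le> n" for k
  proof
    have mk: "min k (Suc n) = k" "min (Suc k) (Suc n) = Suc k" using that by auto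
    fix w assume "w \<in> R k"
    then obtain v where v: "v \<in> carrier_vec (k * m)" "w = B k *\<^sub>v v" unfolding R_def mk by blast
    then have "w = B (Suc k) *\<^sub>v (0\<^sub>v m @\<^sub>v v)"
      using predictor_tail[OF P P ne] that by simp
    moreover have "0\<^sub>v m @\<^sub>v v \<in> carrier_vec (Suc k * m)" using v by simp
    ultimately show "w \<in> R (Suc k)" unfolding R_def mk by blast
  qed
  obtain k where k: "k \<le> n" "R (Suc k) = R k"
    using subspace_chain_stabilises[of R n] R_carr R_zero R_add R_smult R_mono by metis
  have Rk: "R k = (\<lambda>v. B k *\<^sub>v v) ` carrier_vec (k * m)"
    and RSk: "R (Suc k) = (\<lambda>v. B (Suc k) *\<^sub>v v) ` carrier_vec (Suc k * m)"
    unfolding R_def using k(1) by simp_all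
  \<comment> \<open>Going through \<open>R (Suc k) = R k\<close> also covers \<open>k = 0\<close>,
    in which case \<open>R 1\<close> is zero.\<close>
  have "R 1 \<subseteq> R (Suc j)" if "j \<le> n" for j
    using that by (induction j) (use R_mono in force)+
  then have R1: "R 1 \<subseteq> R k" using k by auto
  have Pk: "predictor k (\<Phi> k) (B k)" "predictor (Suc k) (\<Phi> (Suc k)) (B (Suc k))"
    using P k(1) by simp_all
  have B1: "B 1 \<in> carrier_mat n m" using predictor_carrier[OF P[of 1]] by simp
  have Bk: "B k \<in> carrier_mat n (k * m)" "B (Suc k) \<in> carrier_mat n (Suc k * m)"
    using predictor_carrier[OF Pk(1)] predictor_carrier[OF Pk(2)] .

  \<comment> \<open>\<open>T\<close> maps \<open>R k\<close> onto the first block, and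
    \<open>S\<close> turns first-block coordinates into stacked inputs that \<open>B k\<close> sends
    to the corresponding vector.\<close>
  obtain n1 n2 T S where n: "n1 + n2 = n" and T: "T \<in> carrier_mat n n" "invertible_mat T"
    and S: "S \<in> carrier_mat (k * m) n1" and TBS: "T * B k * S = 1\<^sub>m n1 @\<^sub>r 0\<^sub>m n2 n1"
    and TB: "\<And>v. v \<in> carrier_vec (k * m) \<Longrightarrow> vec_last (T *\<^sub>v (B k *\<^sub>v v)) n2 = 0\<^sub>v n2"
    using column_space_normal_form[OF Bk(1)] by blast
  obtain T' where T': "T' \<in> carrier_mat n n" "T' * T = 1\<^sub>m n"
    using invertible_mat_obtain_inverse[OF T] by blast
  have last_R: "vec_last (T *\<^sub>v w) n2 = 0\<^sub>v n2" if "w \<in> R k" for w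
    using that TB by (auto simp: Rk)
  \<comment> \<open>Multiplication by \<open>?J\<close> appends a zero last input, so
    \<open>L\<close> below gives the increment of \<open>f\<close> along \<open>B k\<close>.\<close>
  let ?J = "1\<^sub>m (k * m) @\<^sub>r 0\<^sub>m m (k * m) :: real mat"
  have J: "?J \<in> carrier_mat (Suc k * m) (k * m)"
    using carrier_append_rows[of "1\<^sub>m (k * m) :: real mat" "k * m" "k * m" "0\<^sub>m m (k * m)" m]
    by (simp add: add.commute)
  have Jv: "?J *\<^sub>v v = v @\<^sub>v 0\<^sub>v m" if "v \<in> carrier_vec (k * m)" for v
    using that by (subst mat_mult_append) (auto simp: zero_mat_mult_vec)
  define L where "L = B (Suc k) * ?J"
  have L: "L \<in> carrier_mat n (k * m)" using Bk J by (simp add: L_def)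
  have Lv: "L *\<^sub>v v = B (Suc k) *\<^sub>v (v @\<^sub>v 0\<^sub>v m)" if "v \<in> carrier_vec (k * m)" for v
    unfolding L_def using assoc_mult_mat_vec[OF Bk(2) J that] Jv[OF that] by simp
  \<comment> \<open>Stabilisation enters here: \<open>L\<close> takes values in
    \<open>R (Suc k) = R k\<close>, so the increment stays in the first block.\<close>
  have LR: "L *\<^sub>v v \<in> R k" if "v \<in> carrier_vec (k * m)" for v
  proof -
    have "v @\<^sub>v 0\<^sub>v m \<in> carrier_vec (Suc k * m)"
      using append_carrier_vec[OF that zero_carrier_vec[of m]] by (simp add: add.commute)
    then show ?thesis unfolding Lv[OF that] k(2)[symmetric] RSk by (rule imageI)
  qed
  \<comment> \<open>\<open>C\<close> is this increment along first-block directions, read in the new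
    coordinates; \<open>D\<close> is likewise the first block of \<open>B 1\<close>.\<close>
  have "T * L * S \<in> carrier_mat (n1 + n2) n1" using T L S n by auto
  then obtain C where C: "C \<in> carrier_mat n1 n1"
      "\<And>v. v \<in> carrier_vec n1 \<Longrightarrow> vec_first ((T * L * S) *\<^sub>v v) n1 = C *\<^sub>v v"
    by (rule vec_first_mult_mat) metis
  have "T * B 1 \<in> carrier_mat (n1 + n2) m" using T B1 n by auto
  then obtain D where D: "D \<in> carrier_mat n1 m"
      "\<And>v. v \<in> carrier_vec m \<Longrightarrow> vec_first ((T * B 1) *\<^sub>v v) n1 = D *\<^sub>v v"
    by (rule vec_first_mult_mat) metis

  define \<phi> where "\<phi> = \<Phi> 1"
  have \<phi>c: "\<phi> x \<in> carrier_vec n" if "x \<in> X" for x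
    using P[of 1] that by (auto simp: predictor_def \<phi>_def)
  have f_eq: "f x u = \<phi> x + B 1 *\<^sub>v u" if "x \<in> X" "u \<in> U" for x u
  proof -
    have "stack (\<lambda>_. u) 1 = u" by (intro eq_vecI) auto
    moreover have "state f x (\<lambda>_. u) 1 = \<Phi> 1 x + B 1 *\<^sub>v stack (\<lambda>_. u) 1"
      using P[of 1] that unfolding predictor_def by auto
    ultimately show ?thesis by (simp add: \<phi>_def)
  qed
  let ?fst = "\<lambda>x. vec_first (T *\<^sub>v x) n1" and ?snd = "\<lambda>x. vec_last (T *\<^sub>v x) n2"
  have fst_add: "?fst (v + w) = ?fst v + ?fst w" and snd_add: "?snd (v + w) = ?snd v + ?snd w"
    if "v \<in> carrier_vec n" "w \<in> carrier_vec n" for v w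
    using that T n by (simp_all add: mult_add_distrib_mat_vec vec_first_add[of _ n1 n2] vec_last_add[of _ n1 n2])
  \<comment> \<open>These two invariants make \<open>h\<close> and \<open>g\<close> functions of the
    second block alone.\<close>
  have step: "?snd (\<phi> x) = ?snd (\<phi> y) \<and> ?fst (\<phi> x) - C *\<^sub>v ?fst x = ?fst (\<phi> y) - C *\<^sub>v ?fst y"
    if x: "x \<in> X" and y: "y \<in> X" and xy: "?snd x = ?snd y" for x y
  proof -
    have xc: "x \<in> carrier_vec n" "y \<in> carrier_vec n" "x - y \<in> carrier_vec n"
      using X_carrier x y by auto
    have xyd: "x = y + (x - y)" using xc by (intro eq_vecI) auto
    define z where "z = ?fst (x - y)"
    have z: "z \<in> carrier_vec n1" by (simp add: z_def)
    have fz: "?fst x = ?fst y + z" using fst_add[OF xc(2,3)] xyd by (simp add: z_def)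
    have "?snd y + ?snd (x - y) = ?snd y" using snd_add[OF xc(2,3)] xyd xy by simp
    then have "?snd (x - y) = 0\<^sub>v n2"
      by (rule add_vec_eq_selfD) simp_all
    \<comment> \<open>The difference of two states with equal second block lies in
      \<open>R k\<close>; multiplying by \<open>T'\<close> exhibits the stacked inputs
      \<open>S *\<^sub>v z\<close> that produce it.\<close>
    then have "T *\<^sub>v (x - y) = (T * B k * S) *\<^sub>v z"
      unfolding TBS z_def using T xc n by (intro vec_last_0_decomp) auto
    also have "\<dots> = T *\<^sub>v (B k *\<^sub>v (S *\<^sub>v z))"
      using T Bk(1) S z assoc_mult_mat_vec[of "T * B k" n "k * m" S n1 z]
        assoc_mult_mat_vec[of T n n "B k" "k * m" "S *\<^sub>v z"] by simp
    finally have "(T' * T) *\<^sub>v (x - y) = (T' * T) *\<^sub>v (B k *\<^sub>v (S *\<^sub>v z))"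
      using T T'(1) xc Bk(1) S z by (simp add: assoc_mult_mat_vec)
    then have d: "x - y = B k *\<^sub>v (S *\<^sub>v z)" unfolding T'(2) using xc Bk(1) S z by simp
    define v where "v = S *\<^sub>v z"
    have v: "v \<in> carrier_vec (k * m)" using S z by (simp add: v_def)
    have xv: "x = y + B k *\<^sub>v v" using xyd d by (simp add: v_def)
    obtain u where u: "u \<in> U" using surjE[OF x] by blast
    have "f x u = f y u + L *\<^sub>v v"
      using affine_along_predictor[OF Pk(1,2) y v u] x k xv Lv[OF v] by simp
    then have "\<phi> x + B 1 *\<^sub>v u = \<phi> y + B 1 *\<^sub>v u + L *\<^sub>v v" using f_eq x y u by simp
    then have i: "(\<phi> x + B 1 *\<^sub>v u) $ i = (\<phi> y + B 1 *\<^sub>v u + L *\<^sub>v v) $ i" for i by simp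
    have Lc: "L *\<^sub>v v \<in> carrier_vec n" and Bc: "B 1 *\<^sub>v u \<in> carrier_vec n"
      using mult_mat_vec_in_carrier L B1 by auto
    have e: "\<phi> x = \<phi> y + L *\<^sub>v v"
    proof (rule eq_vecI)
      fix j assume "j < dim_vec (\<phi> y + L *\<^sub>v v)"
      then show "\<phi> x $ j = (\<phi> y + L *\<^sub>v v) $ j"
        using i[of j] B1 L \<phi>c[OF x] \<phi>c[OF y] by (simp del: index_mult_mat_vec)
    qed (use L \<phi>c[OF x] in simp)
    have "?snd (\<phi> x) = ?snd (\<phi> y) + 0\<^sub>v n2"
      using snd_add[OF \<phi>c[OF y] Lc] e last_R[OF LR[OF v]] by simp
    moreover have "T *\<^sub>v (L *\<^sub>v v) = (T * L * S) *\<^sub>v z"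
      using T L S z assoc_mult_mat_vec[of "T * L" n "k * m" S n1 z]
        assoc_mult_mat_vec[of T n n L "k * m" "S *\<^sub>v z"] by (simp add: v_def)
    then have "?fst (\<phi> x) = ?fst (\<phi> y) + C *\<^sub>v z"
      using fst_add[OF \<phi>c[OF y] Lc] e C(2)[OF z] by simp
    moreover have "C *\<^sub>v ?fst x = C *\<^sub>v ?fst y + C *\<^sub>v z"
      unfolding fz using C(1) z by (simp add: mult_add_distrib_mat_vec)
    moreover have "C *\<^sub>v ?fst y \<in> carrier_vec n1" "C *\<^sub>v z \<in> carrier_vec n1"
      by (rule mult_mat_vec_in_carrier[OF C(1)])+
    moreover have "(a + c) - (b + c) = a - b"
      if "a \<in> carrier_vec n1" "b \<in> carrier_vec n1" "c \<in> carrier_vec n1" for a b c :: "real vec"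
      using that by (intro eq_vecI) auto
    ultimately show ?thesis by simp
  qed
  \<comment> \<open>A choice of state with prescribed second block; by \<open>step\<close> the
    resulting values of \<open>g\<close> and \<open>h\<close> do not depend on it.\<close>
  define r where "r z = (SOME x. x \<in> X \<and> ?snd x = z)" for z
  have r: "r (?snd x) \<in> X" "?snd (r (?snd x)) = ?snd x" if "x \<in> X" for x
    using someI[of "\<lambda>y. y \<in> X \<and> ?snd y = ?snd x" x] that by (auto simp: r_def)
  define g where "g z = ?fst (\<phi> (r z)) - C *\<^sub>v ?fst (r z)" for z
  define h where "h z = ?snd (\<phi> (r z))" for z
  have eq: "T *\<^sub>v f x u = ((g (?snd x) + C *\<^sub>v ?fst x) @\<^sub>v h (?snd x)) + (D @\<^sub>r 0\<^sub>m n2 m) *\<^sub>v u"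
    if x: "x \<in> X" and u: "u \<in> U" for x u
  proof -
    have uc: "u \<in> carrier_vec m" and c: "B 1 *\<^sub>v u \<in> carrier_vec n"
      using U_carrier[OF u] mult_mat_vec_in_carrier[OF B1] by auto
    have h: "h (?snd x) = ?snd (\<phi> x)" using step[OF x r(1)[OF x]] r(2)[OF x] by (simp add: h_def)
    have "g (?snd x) = ?fst (\<phi> x) - C *\<^sub>v ?fst x"
      using step[OF x r(1)[OF x]] r(2)[OF x] by (simp add: g_def)
    then have g: "g (?snd x) + C *\<^sub>v ?fst x = ?fst (\<phi> x)" using C(1) by (auto intro!: eq_vecI)
    have "?fst (f x u) = ?fst (\<phi> x) + D *\<^sub>v u"
      using fst_add[OF \<phi>c[OF x] c] f_eq[OF x u] D(2)[OF uc] T B1 uc by (simp add: assoc_mult_mat_vec)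
    \<comment> \<open>The input leaves the second block unchanged because \<open>B 1\<close> maps
      into \<open>R 1 \<subseteq> R k\<close>.\<close>
    moreover have "B 1 *\<^sub>v u \<in> R 1" using uc by (auto simp: R_def)
    then have "?snd (f x u) = ?snd (\<phi> x) + 0\<^sub>v n2"
      using snd_add[OF \<phi>c[OF x] c] f_eq[OF x u] last_R R1 by auto
    ultimately have "T *\<^sub>v f x u = (?fst (\<phi> x) + D *\<^sub>v u) @\<^sub>v (?snd (\<phi> x) + 0\<^sub>v n2)"
      using vec_first_last_append[of "T *\<^sub>v f x u" n1 n2] T n X_carrier[OF f_in[OF x u]] by simp
    also have "\<dots> = (?fst (\<phi> x) @\<^sub>v ?snd (\<phi> x)) + ((D *\<^sub>v u) @\<^sub>v 0\<^sub>v n2)"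
      using D(1) uc by (subst append_vec_add[of _ n1 _ _ n2]) auto
    also have "(D *\<^sub>v u) @\<^sub>v 0\<^sub>v n2 = (D @\<^sub>r 0\<^sub>m n2 m) *\<^sub>v u"
      using D(1) uc by (subst mat_mult_append) (auto simp: zero_mat_mult_vec)
    finally show ?thesis using g h by simp
  qed
  have "CAP_form n m X U f T"
    unfolding CAP_form_def Let_def
    by (rule exI[of _ n1], rule exI[of _ n2], rule exI[of _ g], rule exI[of _ h], rule exI[of _ C],
        rule exI[of _ D]) (use n C(1) D(1) eq in \<open>auto simp: g_def h_def\<close>)
  then show ?thesis using T by blast
qed

text \<open>By induction on \<open>N\<close>, the second block is a function of the initial state
  only, so \<open>g\<close> contributes no input dependence and the inputs enter the first block
  through \<open>C\<close> and \<open>D\<close>. The inverse \<open>T'\<close> then returns to the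
  original coordinates.\<close>

lemma linear_predictor_if_CAP_form:
  assumes T: "T \<in> carrier_mat n n" "invertible_mat T" and CAP: "CAP_form n m X U f T"
  shows "linear_predictor n m X U f N"
proof -
  obtain n1 n2 g h C D where n: "n1 + n2 = n"
    and g: "g \<in> (\<lambda>x. vec_last (T *\<^sub>v x) n2) ` X \<rightarrow> carrier_vec n1"
    and h: "h \<in> (\<lambda>x. vec_last (T *\<^sub>v x) n2) ` X \<rightarrow> carrier_vec n2"
    and C: "C \<in> carrier_mat n1 n1" and D: "D \<in> carrier_mat n1 m"
    and eq: "\<forall>x\<in>X. \<forall>u\<in>U. T *\<^sub>v f x u =
      ((g (vec_last (T *\<^sub>v x) n2) + C *\<^sub>v vec_first (T *\<^sub>v x) n1) @\<^sub>v h (vec_last (T *\<^sub>v x) n2))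
        + (D @\<^sub>r 0\<^sub>m n2 m) *\<^sub>v u"
    using CAP unfolding CAP_form_def Let_def by (elim exE conjE) (rule that, assumption+)
  obtain T' where T': "T' \<in> carrier_mat n n" "T' * T = 1\<^sub>m n"
    using invertible_mat_obtain_inverse[OF T] by blast
  let ?fst = "\<lambda>x. vec_first (T *\<^sub>v x) n1" and ?snd = "\<lambda>x. vec_last (T *\<^sub>v x) n2"
  have fs: "?fst (f x u) = g (?snd x) + C *\<^sub>v ?fst x + D *\<^sub>v u" "?snd (f x u) = h (?snd x)"
    if x: "x \<in> X" and u: "u \<in> U" for x u
  proof -
    have gc: "g (?snd x) \<in> carrier_vec n1" and hc: "h (?snd x) \<in> carrier_vec n2"
      using g h x by auto
    have uc: "u \<in> carrier_vec m" using U_carrier[OF u] .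
    have "(D @\<^sub>r 0\<^sub>m n2 m) *\<^sub>v u = (D *\<^sub>v u) @\<^sub>v 0\<^sub>v n2"
      using D uc by (subst mat_mult_append) (auto simp: zero_mat_mult_vec)
    then have "T *\<^sub>v f x u = (g (?snd x) + C *\<^sub>v ?fst x + D *\<^sub>v u) @\<^sub>v (h (?snd x) + 0\<^sub>v n2)"
      using eq x u gc hc C D uc by (simp add: append_vec_add[of _ n1 _ _ n2])
    moreover have "g (?snd x) + C *\<^sub>v ?fst x + D *\<^sub>v u \<in> carrier_vec n1" using gc C D uc by auto
    ultimately show "?fst (f x u) = g (?snd x) + C *\<^sub>v ?fst x + D *\<^sub>v u" "?snd (f x u) = h (?snd x)"
      using hc by (simp_all add: vec_first_append vec_last_append)
  qed
  have "\<exists>p q E. p \<in> X \<rightarrow> carrier_vec n1 \<and> E \<in> carrier_mat n1 (N * m) \<and>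
      (\<forall>x\<in>X. \<forall>u. (\<forall>t<N. u t \<in> U) \<longrightarrow>
        ?fst (state f x u N) = p x + E *\<^sub>v stack u N \<and> ?snd (state f x u N) = q x)"
  proof (induction N)
    case 0
    show ?case
      by (rule exI[of _ ?fst], rule exI[of _ ?snd], rule exI[of _ "0\<^sub>m n1 0"])
        (auto simp: zero_mat_mult_vec)
  next
    case (Suc N)
    then obtain p q E where p: "p \<in> X \<rightarrow> carrier_vec n1" and E: "E \<in> carrier_mat n1 (N * m)"
      and IH: "\<And>x u. x \<in> X \<Longrightarrow> (\<forall>t<N. u t \<in> U) \<Longrightarrow> ?fst (state f x u N) = p x + E *\<^sub>v stack u N"
        "\<And>x u. x \<in> X \<Longrightarrow> (\<forall>t<N. u t \<in> U) \<Longrightarrow> ?snd (state f x u N) = q x"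
      by blast
    \<comment> \<open>Earlier inputs pass through \<open>C\<close> and the newest one through
      \<open>D\<close>, so \<open>E'\<close> is the block row \<open>[C * E, D]\<close>.\<close>
    obtain E' where E': "E' \<in> carrier_mat n1 (N * m + m)"
      "\<And>v w. v \<in> carrier_vec (N * m) \<Longrightarrow> w \<in> carrier_vec m \<Longrightarrow> E' *\<^sub>v (v @\<^sub>v w) = (C * E) *\<^sub>v v + D *\<^sub>v w"
      using exists_mat_append_cols[of "C * E" n1 "N * m" D m] C D E by auto
    define p' where "p' x = g (q x) + C *\<^sub>v p x" for x
    \<comment> \<open>The values of \<open>g\<close> are controlled only on the projection of
      \<open>X\<close>; \<open>q x\<close> lies there as the second block of a state reached from
      \<open>x\<close> with a constant input.\<close>
    have gq: "g (q x) \<in> carrier_vec n1" if x: "x \<in> X" for x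
    proof -
      obtain u where u: "u \<in> U" using surjE[OF x] by blast
      have "state f x (\<lambda>_. u) N \<in> X" using state_in[OF x, of N "\<lambda>_. u"] u by simp
      from funcset_mem[OF g imageI[OF this]] show ?thesis using IH(2)[OF x, of "\<lambda>_. u"] u by simp
    qed
    have p': "p' x \<in> carrier_vec n1" if x: "x \<in> X" for x
      unfolding p'_def using gq[OF x] mult_mat_vec_in_carrier[OF C] by simp
    have main: "?fst (state f x u (Suc N)) = p' x + E' *\<^sub>v stack u (Suc N)"
      "?snd (state f x u (Suc N)) = h (q x)"
      if x: "x \<in> X" and u: "\<forall>t<Suc N. u t \<in> U" for x u
    proof -
      let ?y = "state f x u N" and ?s = "stack u N"
      have y: "?y \<in> X" using state_in[OF x] u by simp
      have s: "?s \<in> carrier_vec (N * m)" using u U_carrier by (intro stack_carrier) auto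
      have uN: "u N \<in> U" "u N \<in> carrier_vec m" using u U_carrier by auto
      have ih: "?fst ?y = p x + E *\<^sub>v ?s" "?snd ?y = q x" using IH[OF x] u by simp_all
      have pc: "p x \<in> carrier_vec n1" using p x by auto
      have "?fst (f ?y (u N)) = g (q x) + C *\<^sub>v (p x + E *\<^sub>v ?s) + D *\<^sub>v u N"
        using fs(1)[OF y uN(1)] ih by simp
      also have "C *\<^sub>v (p x + E *\<^sub>v ?s) = C *\<^sub>v p x + (C * E) *\<^sub>v ?s"
        using C E s pc by (simp add: mult_add_distrib_mat_vec assoc_mult_mat_vec)
      also have "g (q x) + (C *\<^sub>v p x + (C * E) *\<^sub>v ?s) + D *\<^sub>v u N
          = (g (q x) + C *\<^sub>v p x) + ((C * E) *\<^sub>v ?s + D *\<^sub>v u N)"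
        using gq[OF x] C E D by (intro eq_vecI) auto
      also have "\<dots> = p' x + E' *\<^sub>v (?s @\<^sub>v u N)"
        using E'(2)[OF s uN(2)] by (simp add: p'_def)
      finally show "?fst (state f x u (Suc N)) = p' x + E' *\<^sub>v stack u (Suc N)" by simp
      show "?snd (state f x u (Suc N)) = h (q x)" using fs(2)[OF y uN(1)] ih by simp
    qed
    show ?case
      by (rule exI[of _ p'], rule exI[of _ "\<lambda>x. h (q x)"], rule exI[of _ E'])
        (use p' E'(1) main in \<open>auto simp: add.commute\<close>)
  qed
  then obtain p q E where p: "p \<in> X \<rightarrow> carrier_vec n1" and E: "E \<in> carrier_mat n1 (N * m)"
    and st: "\<And>x u. x \<in> X \<Longrightarrow> (\<forall>t<N. u t \<in> U) \<Longrightarrow>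
      ?fst (state f x u N) = p x + E *\<^sub>v stack u N \<and> ?snd (state f x u N) = q x"
    by blast
  let ?E = "E @\<^sub>r 0\<^sub>m n2 (N * m)"
  have Ec: "?E \<in> carrier_mat n (N * m)" using carrier_append_rows[OF E zero_carrier_mat, of n2] n by simp
  have "predictor N (\<lambda>x. T' *\<^sub>v (p x @\<^sub>v q x)) (T' * ?E)"
    unfolding predictor_def
  proof (intro conjI ballI allI impI)
    show "(\<lambda>x. T' *\<^sub>v (p x @\<^sub>v q x)) \<in> X \<rightarrow> carrier_vec n" using mult_mat_vec_in_carrier[OF T'(1)] by blast
    show "T' * ?E \<in> carrier_mat n (N * m)" using T'(1) Ec by simp
    fix x u assume x: "x \<in> X" and u: "\<forall>t<N. u t \<in> U"
    let ?y = "state f x u N" and ?s = "stack u N"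
    have y: "?y \<in> carrier_vec n" using X_carrier state_in[OF x] u by simp
    have s: "?s \<in> carrier_vec (N * m)" using u U_carrier by (intro stack_carrier) auto
    have pc: "p x \<in> carrier_vec n1" using p x by auto
    have qc: "q x \<in> carrier_vec n2" using st[OF x u] by (metis vec_last_carrier)
    have pq: "p x @\<^sub>v q x \<in> carrier_vec n" using append_carrier_vec[OF pc qc] n by simp
    have "T *\<^sub>v ?y = (p x + E *\<^sub>v ?s) @\<^sub>v (q x + 0\<^sub>v n2)"
      using vec_first_last_append[of "T *\<^sub>v ?y" n1 n2] st[OF x u] T y n qc by simp
    also have "\<dots> = (p x @\<^sub>v q x) + ((E *\<^sub>v ?s) @\<^sub>v 0\<^sub>v n2)"
      using pc qc E s by (subst append_vec_add) auto
    also have "(E *\<^sub>v ?s) @\<^sub>v 0\<^sub>v n2 = ?E *\<^sub>v ?s"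
      using E s by (subst mat_mult_append) (auto simp: zero_mat_mult_vec)
    finally have "(T' * T) *\<^sub>v ?y = T' *\<^sub>v ((p x @\<^sub>v q x) + ?E *\<^sub>v ?s)"
      using T T'(1) y by (simp add: assoc_mult_mat_vec)
    also have "\<dots> = T' *\<^sub>v (p x @\<^sub>v q x) + (T' * ?E) *\<^sub>v ?s"
      using T'(1) pq Ec s by (simp add: mult_add_distrib_mat_vec[of _ n n] assoc_mult_mat_vec[of _ n n])
    finally show "?y = T' *\<^sub>v (p x @\<^sub>v q x) + (T' * ?E) *\<^sub>v ?s" unfolding T'(2) using y by simp
  qed
  then show ?thesis unfolding linear_predictor_iff by blast
qed

end

theorem theorem1:
  fixes n m :: nat
    and X U :: "real vec set"
    and f :: "real vec \<Rightarrow> real vec \<Rightarrow> real vec"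
  assumes "open_vec_set n X" and "convex_vec_set X"
    and "open_vec_set m U"
    and "(\<lambda>(x, u). f x u) ` (X \<times> U) = X"
  shows "(\<forall>N\<in>{1..n + 1}. linear_predictor n m X U f N) \<longleftrightarrow>
    (\<exists>T\<in>carrier_mat n n. invertible_mat T \<and> CAP_form n m X U f T)"
proof -
  interpret surjective_system n m X U f using assms by unfold_locales
  show ?thesis
  proof (cases "X = {}")
    \<comment> \<open>For empty \<open>X\<close> the CAP form holds with the identity as
      \<open>T\<close> and an empty first block, and it yields the predictors, so both sides are
      true.\<close>
    case True
    have "invertible_mat (1\<^sub>m n :: real mat)"
      by (auto simp: invertible_mat_def inverts_mat_def intro!: exI[of _ "1\<^sub>m n"])
    moreover have "CAP_form n m X U f (1\<^sub>m n)"
      unfolding CAP_form_def True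
      by (rule exI[of _ 0], rule exI[of _ n], intro exI[of _ "\<lambda>_. 0\<^sub>v 0"] exI[of _ "\<lambda>_. 0\<^sub>v n"]
          exI[of _ "0\<^sub>m 0 0"] exI[of _ "0\<^sub>m 0 m"]) auto
    ultimately show ?thesis using linear_predictor_if_CAP_form by (metis one_carrier_mat)
  next
    case False
    then show ?thesis using CAP_form_if_linear_predictors linear_predictor_if_CAP_form by blast
  qed
qed

end
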